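(* Let $m,n\in\mathbb{N}$, $a,b,c\in\mathbb{Z}$ with $a\neq0$, $b\neq0$ and $c\neq0$. Then, for $x,y,z\in\mathbb{R}$, \begin{align*} &ma\,s_{m-1,n}\begin{pmatrix} a & b & c \\ x & y & z\end{pmatrix}+nb\,s_{m,n-1}\begin{pmatrix} a & b & c \\ x & y & z\end{pmatrix}\\ &=(-1)^{n-1}nb^{n-1}\mathrm{sgn}(bc)\sum_{j=0}^{m}\binom{m}{j}\frac{(-1)^{m-j}a^{m-j}}{c^{m+n-j-2}}\,s_{j,m+n-j-1}\begin{pmatrix} a & c & b \\ x & z & y\end{pmatrix}\\ &\quad+(-1)^{m-1}ma^{m-1}\mathrm{sgn}(ac)\sum_{j=0}^{n}\binom{n}{j}\frac{(-1)^{n-j}b^{n-j}}{c^{m+n-j-2}}\,s_{j,m+n-j-1}\begin{pmatrix} b & c & a \\ y & z & x\end{pmatrix}\\ &\quad-\mathrm{sgn}(ab)\frac{\delta_{1,m-1}\delta_{1,n}ma+\delta_{1,m}\delta_{1,n-1}nb}{4}\widetilde{N}, \end{align*} where $\widetilde{N}$ is the number of distinct triples $r,s,t\in\mathbb{Z}$ such that $0\leq\mathrm{sgn}(c)\frac{r+x}{a}=\mathrm{sgn}(c)\frac{s+y}{b}=\mathrm{sgn}(c)\frac{t+z}{c}<1$.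
   Context: Notation: $\{x\}$ is the fractional part of $x$. The Bernoulli functions are $\overline{B}_0(x)=1$, $\overline{B}_1(x)=((x))$ (equal to $\{x\}-\tfrac12$ if $x\notin\mathbb{Z}$ and $0$ if $x\in\mathbb{Z}$), and $\overline{B}_n(x)=B_n(\{x\})$ for $n\geq2$, where $B_n$ is the $n$-th Bernoulli polynomial. For $m,n\in\mathbb{N}_0$, $a,b,c\in\mathbb{Z}$, $x,y,z\in\mathbb{R}$ with $c\neq0$, the generalized Dedekind–Rademacher sums are $s_{m,n}\begin{pmatrix} a & b & c \\ x & y & z\end{pmatrix}=\sum_{r=1}^{|c|}\overline{B}_{m}\bigl(\frac{a(r+z)}{c}-x\bigr)\overline{B}_{n}\bigl(\frac{b(r+z)}{c}-y\bigr)$. $\mathrm{sgn}$ is the sign function; $\delta_{l,k}$ is the Kronecker delta. *)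

theory Defs
  imports "HOL-Analysis.Analysis"
begin

text \<open>
  Bernoulli numbers with the convention \<open>B\<^sub>1 = -1/2\<close>; the recursion is
  \<open>\<Sum>k\<le>n. (n + 1 choose k) * B\<^sub>k = 0\<close> for \<open>n \<ge> 1\<close>, solved for \<open>B\<^sub>n\<close>.
\<close>

fun bernoulli :: "nat \<Rightarrow> real" where
  "bernoulli 0 = 1"
| "bernoulli (Suc n) =
     - (\<Sum>k\<le>n. real ((n + 2) choose k) * bernoulli k) / real (n + 2)"

definition bernpoly :: "nat \<Rightarrow> real \<Rightarrow> real" where
  "bernpoly n x = (\<Sum>k\<le>n. real (n choose k) * bernoulli k * x ^ (n - k))"

lemma bernoulli_sum:
  "(\<Sum>k\<le>n. real (Suc n choose k) * bernoulli k) = (if n = 0 then 1 else 0)"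
  by (cases n) (auto simp: field_simps)

lemma bernoulli_egf:
  "Abs_fps (\<lambda>n. bernoulli n / fact n) * (fps_exp 1 - 1) = (fps_X :: real fps)"
proof (rule fps_ext)
  fix N :: nat
  show "fps_nth (Abs_fps (\<lambda>n. bernoulli n / fact n) * (fps_exp 1 - 1)) N
          = fps_nth (fps_X :: real fps) N"
  proof (cases N)
    case 0
    then show ?thesis by (simp add: fps_mult_nth)
  next
    case (Suc n)
    have "fps_nth (Abs_fps (\<lambda>n. bernoulli n / fact n) * (fps_exp 1 - 1)) N
        = (\<Sum>k\<le>Suc n. bernoulli k / fact k *
             fps_nth (fps_exp 1 - 1) (Suc n - k))"
      by (simp add: fps_mult_nth Suc atLeast0AtMost)
    also have "\<dots> = (\<Sum>k\<le>n. bernoulli k / fact k * (1 / fact (Suc n - k)))"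
      by (simp, intro sum.cong) (auto simp: Suc_diff_le)
    also have "\<dots> = (\<Sum>k\<le>n. real (Suc n choose k) * bernoulli k) / fact (Suc n)"
      unfolding sum_divide_distrib
      by (intro sum.cong) (auto simp: binomial_fact field_simps simp del: fact_Suc binomial_Suc_Suc)
    also have "\<dots> = fps_nth (fps_X :: real fps) N"
      by (simp add: bernoulli_sum Suc del: binomial_Suc_Suc)
    finally show ?thesis .
  qed
qed

lemma bernpoly_egf:
  "Abs_fps (\<lambda>n. bernpoly n x / fact n) * (fps_exp 1 - 1) = fps_X * fps_exp x"
proof -
  have "Abs_fps (\<lambda>n. bernpoly n x / fact n)
      = Abs_fps (\<lambda>n. bernoulli n / fact n) * fps_exp x"
  proof (rule fps_ext)
    fix n :: nat
    have "bernpoly n x / fact n = (\<Sum>k\<le>n. bernoulli k / fact k * (x ^ (n - k) / fact (n - k)))"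
      unfolding bernpoly_def sum_divide_distrib
      by (intro sum.cong) (auto simp: binomial_fact field_simps)
    then show "fps_nth (Abs_fps (\<lambda>n. bernpoly n x / fact n)) n
        = fps_nth (Abs_fps (\<lambda>n. bernoulli n / fact n) * fps_exp x) n"
      by (simp add: fps_mult_nth atLeast0AtMost)
  qed
  then have "Abs_fps (\<lambda>n. bernpoly n x / fact n) * (fps_exp 1 - 1)
      = (Abs_fps (\<lambda>n. bernoulli n / fact n) * (fps_exp 1 - 1)) * fps_exp x"
    by (simp only: mult.assoc mult.commute[of "fps_exp x"])
  then show ?thesis
    by (simp only: bernoulli_egf)
qed

definition bernoulli_fun :: "nat \<Rightarrow> real \<Rightarrow> real" where
  "bernoulli_fun n x =
     (if n = 0 then 1
      else if n = 1 then (if x \<in> \<int> then 0 else frac x - 1 / 2)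
      else bernpoly n (frac x))"

definition dedekind_rademacher_sum ::
  "nat \<Rightarrow> nat \<Rightarrow> int \<Rightarrow> int \<Rightarrow> int \<Rightarrow> real \<Rightarrow> real \<Rightarrow> real \<Rightarrow> real" where
  "dedekind_rademacher_sum m n a b c x y z =
     (\<Sum>r = 1..\<bar>c\<bar>.
        bernoulli_fun m (of_int a * (of_int r + z) / of_int c - x) *
        bernoulli_fun n (of_int b * (of_int r + z) / of_int c - y))"

end

theory Submission
  imports Defs
begin

text \<open>
  Let \<open>G(u, x) = \<Sum>k. B\<^sub>k(x) u\<^sup>k / k!\<close> be the exponential generating function of the Bernoulli
  functions. Off the integers it satisfies \<open>G' = u G\<close>, and at an integer it jumps by \<open>-u\<close>, its value
  there being the mean of the one-sided limits. Put \<open>w = a u + b v\<close>. As functions of \<open>t\<close>,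
  \<^item> \<open>w G(u, a t - x) G(v, b t - y)\<close> and
  \<^item> \<open>sgn b v \<Sum>p. G(u, a p - x) G(w, t - p) + sgn a u \<Sum>q. G(v, b q - y) G(w, t - q)\<close>,

  with \<open>p\<close> and \<open>q\<close> running over the jumps modulo 1 of the second and of the first factor, are 1-periodic,
  grow like \<open>exp (w t)\<close> between jumps and have the same jumps, so they agree. Only at a common jump
  of both factors does the product of the means differ from the mean of the products, by a quarter
  of the product of the jumps; this is the correction term. Comparing coefficients of \<open>u\<^sup>m v\<^sup>n\<close>
  gives the theorem for \<open>c = 1\<close>, \<open>z = t\<close>, while \<open>v = 0\<close> gives Raabe's multiplication formula.
  Summing the former over \<open>t = (r + z) / c\<close> by means of the latter yields the general case.

  To stay with univariate real power series, \<open>u\<close> and \<open>v\<close> are replaced by \<open>\<alpha> X\<close> and \<open>\<beta> X\<close> with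
  real numbers \<open>\<alpha>\<close> and \<open>\<beta>\<close>.
\<close>

section \<open>Generating functions of the Bernoulli functions\<close>

definition bernoulli_gf :: "real \<Rightarrow> real \<Rightarrow> real fps" where
  "bernoulli_gf \<alpha> x = Abs_fps (\<lambda>k. bernoulli_fun k x * \<alpha> ^ k / fact k)"

lemma bernoulli_gf_nth [simp]:
  "fps_nth (bernoulli_gf \<alpha> x) k = bernoulli_fun k x * \<alpha> ^ k / fact k"
  by (simp add: bernoulli_gf_def)

lemma bernoulli_fun_add_int:
  assumes "k \<in> \<int>"
  shows "bernoulli_fun n (x + k) = bernoulli_fun n x"
proof -
  have "frac (x + k) = frac x" "x + k \<in> \<int> \<longleftrightarrow> x \<in> \<int>"
    using assms by (auto elim!: Ints_cases simp: frac_def)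
  then show ?thesis by (simp add: bernoulli_fun_def)
qed

lemma bernoulli_gf_add_int:
  assumes "k \<in> \<int>"
  shows "bernoulli_gf \<alpha> (x + k) = bernoulli_gf \<alpha> x"
  using assms by (simp add: bernoulli_gf_def bernoulli_fun_add_int)

text \<open>The polynomial value fails only for index 1 at an integer, where the mean 0 of the
  one-sided limits replaces \<open>-1/2\<close>.\<close>

lemma bernoulli_fun_conv_bernpoly:
  "bernoulli_fun n x = bernpoly n (frac x) + (if n = 1 \<and> x \<in> \<int> then 1 / 2 else 0)"
  by (auto simp: bernoulli_fun_def bernpoly_def frac_eq_0_iff[THEN iffD2])

text \<open>This is \<open>\<alpha> X / (exp (\<alpha> X) - 1)\<close>; giving it by its
  coefficients makes it 1 at \<open>\<alpha> = 0\<close>.\<close>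

definition bernoulli_num_gf :: "real \<Rightarrow> real fps" where
  "bernoulli_num_gf \<alpha> = Abs_fps (\<lambda>k. bernoulli k * \<alpha> ^ k / fact k)"

text \<open>Substitution of \<open>\<alpha> X\<close> for \<open>X\<close> in
  \<open>bernoulli_egf\<close>.\<close>

lemma bernoulli_num_gf_mult:
  "bernoulli_num_gf \<alpha> * (fps_exp \<alpha> - 1) = fps_const \<alpha> * fps_X"
proof -
  let ?s = "fps_const \<alpha> * fps_X :: real fps"
  have "fps_compose (Abs_fps (\<lambda>n. bernoulli n / fact n) * (fps_exp 1 - 1)) ?s = fps_compose fps_X ?s"
    by (simp only: bernoulli_egf)
  moreover have "fps_compose (Abs_fps (\<lambda>n. bernoulli n / fact n)) ?s = bernoulli_num_gf \<alpha>"
    unfolding fps_compose_linear bernoulli_num_gf_def by (simp add: mult.commute)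
  moreover have "fps_compose (fps_exp 1) ?s = fps_exp \<alpha>"
    unfolding fps_compose_linear by (simp add: fps_exp_def)
  ultimately show ?thesis
    by (simp add: fps_compose_mult_distrib fps_compose_sub_distrib)
qed

lemma bernpoly_gf:
  "Abs_fps (\<lambda>n. bernpoly n x * \<alpha> ^ n / fact n) = bernoulli_num_gf \<alpha> * fps_exp (\<alpha> * x)"
proof (rule fps_ext)
  fix n :: nat
  have "bernpoly n x * \<alpha> ^ n / fact n
      = (\<Sum>k\<le>n. (bernoulli k * \<alpha> ^ k / fact k) * ((\<alpha> * x) ^ (n - k) / fact (n - k)))"
    unfolding bernpoly_def sum_divide_distrib sum_distrib_right
    by (intro sum.cong)
       (auto simp: binomial_fact field_simps power_mult_distrib simp flip: power_add)
  then show "fps_nth (Abs_fps (\<lambda>n. bernpoly n x * \<alpha> ^ n / fact n)) n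
      = fps_nth (bernoulli_num_gf \<alpha> * fps_exp (\<alpha> * x)) n"
    by (simp add: fps_mult_nth atLeast0AtMost bernoulli_num_gf_def)
qed

lemma bernoulli_gf_eq:
  "bernoulli_gf \<alpha> x = bernoulli_num_gf \<alpha> * fps_exp (\<alpha> * frac x)
     + fps_const (\<alpha> * of_bool (x \<in> \<int>) / 2) * fps_X"
  unfolding bernpoly_gf[symmetric]
  by (rule fps_ext) (auto simp: bernoulli_fun_conv_bernpoly field_simps)

section \<open>Behaviour near a point: exponential growth and jumps\<close>

text \<open>
  The factor \<open>sgn \<delta>\<close> covers both one-sided expansions and, as \<open>sgn 0 = 0\<close>, the value at \<open>x\<close> itself.
\<close>

lemma bernoulli_gf_local:
  "\<forall>\<^sub>F \<delta> in nhds 0.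
     bernoulli_gf \<alpha> (x + \<delta>) = fps_exp (\<alpha> * \<delta>) *
       (bernoulli_gf \<alpha> x - fps_const (sgn \<delta> / 2 * \<alpha> * of_bool (x \<in> \<int>)) * fps_X)
     \<and> (x + \<delta> \<in> \<int> \<longrightarrow> \<delta> = 0)"
proof (cases "x \<in> \<int>")
  case False
  then have fx: "0 < frac x" "frac x < 1"
    by (auto simp: frac_gt_0_iff frac_lt_1)
  \<comment> \<open>In this window \<open>x + \<delta>\<close> stays strictly between the two
    integers around \<open>x\<close>.\<close>
  have "\<forall>\<^sub>F \<delta> in nhds (0::real). \<delta> \<in> {- frac x <..< 1 - frac x}"
    by (rule eventually_nhds_in_open) (use fx in auto)
  then show ?thesis
  proof eventually_elim
    case (elim \<delta>)
    have "x + \<delta> - (frac x + \<delta>) \<in> \<int>" by (simp add: frac_def)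
    then have "frac (x + \<delta>) = frac x + \<delta>"
      using elim by (subst frac_unique_iff) auto
    moreover from this have "x + \<delta> \<notin> \<int>"
      using elim by (auto simp flip: frac_eq_0_iff)
    ultimately show ?case
      using False by (simp add: bernoulli_gf_eq distrib_left fps_exp_add_mult mult_ac)
  qed
next
  case True
  have "\<forall>\<^sub>F \<delta> in nhds (0::real). \<delta> \<in> {- 1 <..< 1}"
    by (rule eventually_nhds_in_open) auto
  then show ?thesis
  proof eventually_elim
    case (elim \<delta>)
    have frac0: "frac x = 0" using True by simp
    consider "\<delta> = 0" | "\<delta> > 0" | "\<delta> < 0" by linarith
    then show ?case
    proof cases
      case 1
      then show ?thesis by simp
    next
      case 2
      then have fr: "frac (x + \<delta>) = \<delta>"
        using elim True by (subst frac_unique_iff) auto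
      with 2 have "x + \<delta> \<notin> \<int>" by (auto simp flip: frac_eq_0_iff)
      then show ?thesis
        using 2 True fr by (simp add: bernoulli_gf_eq frac0 mult_ac)
    next
      case 3
      then have fr: "frac (x + \<delta>) = 1 + \<delta>"
        using elim True by (subst frac_unique_iff) auto
      with elim have nZ: "x + \<delta> \<notin> \<int>" by (auto simp flip: frac_eq_0_iff)
      \<comment> \<open>To the left of an integer the surplus factor \<open>fps_exp \<alpha>\<close>
        contributes the full jump \<open>\<alpha> X\<close>. One half of it belongs to the mean
        value at \<open>x\<close>, the other half is the term with
        \<open>sgn \<delta>\<close>.\<close>
      have "bernoulli_gf \<alpha> (x + \<delta>) = bernoulli_num_gf \<alpha> * fps_exp \<alpha> * fps_exp (\<alpha> * \<delta>)"
        using nZ by (simp add: bernoulli_gf_eq fr distrib_left fps_exp_add_mult mult_ac)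
      also have "bernoulli_num_gf \<alpha> * fps_exp \<alpha> = bernoulli_num_gf \<alpha> + fps_const \<alpha> * fps_X"
        using bernoulli_num_gf_mult[of \<alpha>] by (simp add: algebra_simps)
      also have "\<dots> = bernoulli_num_gf \<alpha> + (fps_const (\<alpha> / 2) + fps_const (\<alpha> / 2)) * fps_X"
        by simp
      also have "\<dots> = bernoulli_gf \<alpha> x - fps_const (sgn \<delta> / 2 * \<alpha> * of_bool (x \<in> \<int>)) * fps_X"
        using 3 True by (simp add: bernoulli_gf_eq frac0 algebra_simps)
      finally show ?thesis using nZ by (simp add: mult_ac)
    qed
  qed
qed

text \<open>Pullback along the map from \<open>t\<close> to \<open>a (t - s)\<close>: a negative
  \<open>a\<close> swaps the two sides and so reverses the jump. The second conjunct, that integer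
  points are isolated, later removes the correction term near \<open>s\<close>.\<close>

lemma bernoulli_gf_affine_local:
  fixes a :: int
  assumes "a \<noteq> 0"
  shows "\<forall>\<^sub>F t in nhds s.
     bernoulli_gf \<alpha> (of_int a * t - x) = fps_exp (\<alpha> * of_int a * (t - s)) *
       (bernoulli_gf \<alpha> (of_int a * s - x)
          - fps_const (sgn (t - s) / 2 * of_int (sgn a) * \<alpha> * of_bool (of_int a * s - x \<in> \<int>)) * fps_X)
     \<and> (of_int a * t - x \<in> \<int> \<longrightarrow> t = s)"
proof -
  have "((\<lambda>t. of_int a * (t - s)) \<longlongrightarrow> of_int a * (s - s)) (nhds s)"
    by (intro tendsto_intros filterlim_ident)
  then have "filterlim (\<lambda>t. of_int a * (t - s)) (nhds 0) (nhds s)" by simp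
  from eventually_compose_filterlim[OF bernoulli_gf_local this, where x1 = "of_int a * s - x" and \<alpha>1 = \<alpha>]
  show ?thesis
  proof eventually_elim
    case (elim t)
    have "of_int a * s - x + of_int a * (t - s) = of_int a * t - x"
      by (simp add: algebra_simps)
    moreover have "sgn (of_int a * (t - s)) = of_int (sgn a) * sgn (t - s)"
      by (simp add: sgn_mult) (simp add: sgn_if)
    moreover have "\<alpha> * (of_int a * (t - s)) = \<alpha> * of_int a * (t - s)"
      by simp
    moreover have "sgn (of_int a * (t - s)) / 2 * \<alpha> = sgn (t - s) / 2 * of_int (sgn a) * \<alpha>"
      using calculation(2) by simp
    moreover have "of_int a * (t - s) = 0 \<longrightarrow> t = s"
      using assms by simp
    ultimately show ?case
      using elim by metis
  qed
qed

section \<open>Uniqueness of periodic functions with exponential growth and no jumps\<close>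

text \<open>The factor \<open>fps_exp (- \<gamma> * t)\<close> turns the growth law into local
  constancy, so on the connected line \<open>D t\<close> is
  \<open>fps_exp (\<gamma> * t) * K\<close>. Equal values at 0 and 1 give
  \<open>(fps_exp \<gamma> - 1) * K = 0\<close>, where the first factor has the nonzero linear
  coefficient \<open>\<gamma>\<close>.\<close>

lemma fps_exp_ode_periodic_unique:
  fixes D :: "real \<Rightarrow> real fps"
  assumes loc: "\<And>s. \<forall>\<^sub>F t in nhds s. D t = fps_exp (\<gamma> * (t - s)) * D s"
    and per: "D 1 = D 0" and "\<gamma> \<noteq> 0"
  shows "D t = 0"
proof -
  define C where "C t = fps_exp (- \<gamma> * t) * D t" for t
  have D: "D t = fps_exp (\<gamma> * t) * C t" for t
    by (simp add: C_def mult.assoc[symmetric] fps_exp_add_mult[symmetric])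
  have "C constant_on UNIV"
  proof (rule locally_constant_imp_constant)
    fix s :: real
    have "\<forall>\<^sub>F t in nhds s. C t = C s"
      using loc[of s]
    proof eventually_elim
      case (elim t)
      have "- \<gamma> * t + \<gamma> * (t - s) = - \<gamma> * s"
        by (simp add: algebra_simps)
      then show ?case
        unfolding C_def elim mult.assoc[symmetric] fps_exp_add_mult[symmetric] by simp
    qed
    then obtain S where "open S" "s \<in> S" "\<forall>t\<in>S. C t = C s"
      unfolding eventually_nhds by blast
    moreover from this have "openin (top_of_set UNIV) S"
      by (simp only: subtopology_UNIV open_openin[symmetric])
    ultimately show "\<exists>T. openin (top_of_set UNIV) T \<and> s \<in> T \<and> (\<forall>x\<in>T. C x = C s)"
      by blast
  qed simp
  then obtain K where K: "C t = K" for t by (auto simp: constant_on_def)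
  have "(fps_exp \<gamma> - 1) * K = 0"
    using per by (simp add: D K algebra_simps)
  moreover have "fps_exp \<gamma> - 1 \<noteq> 0"
  proof
    assume "fps_exp \<gamma> - 1 = 0"
    then have "fps_nth (fps_exp \<gamma> - 1) 1 = 0" by simp
    with \<open>\<gamma> \<noteq> 0\<close> show False by simp
  qed
  ultimately show ?thesis by (simp add: D K)
qed

section \<open>Sums over the jumps of one factor\<close>

text \<open>If \<open>b t - y\<close> is an integer \<open>q\<close>, the condition on
  \<open>r\<close> becomes \<open>b dvd q - r\<close>, which selects one \<open>r\<close> from a
  full residue system; otherwise no \<open>r\<close> qualifies. Thus each jump modulo 1 is met
  exactly once.\<close>

lemma sum_residue_indicator:
  fixes b :: int and y t :: real
  assumes "b \<noteq> 0"
  shows "(\<Sum>r = 1..\<bar>b\<bar>. of_bool (t - (of_int r + y) / of_int b \<in> \<int>))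
    = (of_bool (of_int b * t - y \<in> \<int>) :: real)"
proof -
  have iff: "t - (of_int r + y) / of_int b \<in> \<int> \<longleftrightarrow> (\<exists>k. of_int b * t - y = of_int (r + b * k))" for r
    using assms by (auto simp: Ints_def image_def field_simps)
  show ?thesis
  proof (cases "of_int b * t - y \<in> \<int>")
    case False
    then have "t - (of_int r + y) / of_int b \<notin> \<int>" for r
      unfolding iff by (metis Ints_of_int)
    with False show ?thesis by simp
  next
    case True
    then obtain q where q: "of_int b * t - y = of_int q" by (auto elim: Ints_cases)
    \<comment> \<open>The representative of \<open>q\<close> in \<open>1..\<bar>b\<bar>\<close> and
      not in \<open>0..\<bar>b\<bar> - 1\<close>, hence the shift by one on both sides of
      \<open>mod\<close>.\<close>
    define \<rho> where "\<rho> = (q - 1) mod \<bar>b\<bar> + 1"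
    have iff': "t - (of_int r + y) / of_int b \<in> \<int> \<longleftrightarrow> b dvd q - r" for r
      unfolding iff q by (auto simp: dvd_def algebra_simps simp del: of_int_add of_int_mult of_int_diff)
    have "b dvd q - r \<longleftrightarrow> r = \<rho>" if "r \<in> {1..\<bar>b\<bar>}" for r
    proof -
      have "b dvd q - r \<longleftrightarrow> (q - 1) mod \<bar>b\<bar> = (r - 1) mod \<bar>b\<bar>"
        by (simp add: mod_eq_dvd_iff)
      also have "(r - 1) mod \<bar>b\<bar> = r - 1"
        using that by (intro mod_pos_pos_trivial) auto
      finally show ?thesis by (auto simp: \<rho>_def)
    qed
    then have "(\<Sum>r = 1..\<bar>b\<bar>. of_bool (t - (of_int r + y) / of_int b \<in> \<int>))
       = (\<Sum>r = 1..\<bar>b\<bar>. if r = \<rho> then 1 else 0 :: real)"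
      by (intro sum.cong) (auto simp: iff')
    also have "\<dots> = 1"
    proof -
      have "0 < \<bar>b\<bar>" using assms by simp
      then have "\<rho> \<in> {1..\<bar>b\<bar>}"
        using pos_mod_bound[of "\<bar>b\<bar>" "q - 1"] pos_mod_sign[of "\<bar>b\<bar>" "q - 1"]
        unfolding \<rho>_def atLeastAtMost_iff by linarith
      then show ?thesis by simp
    qed
    finally show ?thesis using True by simp
  qed
qed

text \<open>The points \<open>p = (r + y) / b\<close> are, modulo 1, the jumps of
  \<open>bernoulli_gf \<beta> (b t - y)\<close>. This is the sum over \<open>p\<close> of the
  overview, with \<open>\<gamma> X\<close> for \<open>w\<close>.\<close>

definition rademacher_gf :: "int \<Rightarrow> int \<Rightarrow> real \<Rightarrow> real \<Rightarrow> real \<Rightarrow> real \<Rightarrow> real \<Rightarrow> real fps" where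
  "rademacher_gf a b x y \<alpha> \<gamma> t =
     (\<Sum>r = 1..\<bar>b\<bar>. bernoulli_gf \<alpha> (of_int a * (of_int r + y) / of_int b - x) *
        bernoulli_gf \<gamma> (t - (of_int r + y) / of_int b))"

text \<open>A jump at \<open>s\<close> can only come from the one \<open>p\<close> congruent to
  \<open>s\<close> modulo 1, and the coefficient of that summand is then the value of the other
  factor at \<open>s\<close>.\<close>

lemma rademacher_gf_local:
  assumes "b \<noteq> 0"
  shows "\<forall>\<^sub>F t in nhds s. rademacher_gf a b x y \<alpha> \<gamma> t = fps_exp (\<gamma> * (t - s)) *
     (rademacher_gf a b x y \<alpha> \<gamma> s
        - fps_const (sgn (t - s) / 2 * \<gamma> * of_bool (of_int b * s - y \<in> \<int>)) * fps_X *
          bernoulli_gf \<alpha> (of_int a * s - x))"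
proof -
  define p where "p r = (of_int r + y) / of_int b" for r :: int
  define g where "g r = bernoulli_gf \<alpha> (of_int a * (of_int r + y) / of_int b - x)" for r :: int
  \<comment> \<open>The affine expansion is used with slope 1; as there are finitely many
    \<open>r\<close>, one neighbourhood serves them all.\<close>
  have "\<forall>\<^sub>F t in nhds s. \<forall>r\<in>{1..\<bar>b\<bar>}.
     bernoulli_gf \<gamma> (of_int 1 * t - p r) = fps_exp (\<gamma> * of_int 1 * (t - s)) *
       (bernoulli_gf \<gamma> (of_int 1 * s - p r)
          - fps_const (sgn (t - s) / 2 * of_int (sgn 1) * \<gamma> * of_bool (of_int 1 * s - p r \<in> \<int>)) * fps_X)
     \<and> (of_int 1 * t - p r \<in> \<int> \<longrightarrow> t = s)"
    by (intro eventually_ball_finite ballI bernoulli_gf_affine_local) auto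
  then show ?thesis
  proof eventually_elim
    case (elim t)
    define \<kappa> where "\<kappa> = fps_const (sgn (t - s) / 2 * \<gamma>) * fps_X"
    \<comment> \<open>As \<open>a\<close> is an integer, \<open>a p\<close> and \<open>a s\<close>
      differ by an integer whenever \<open>p\<close> and \<open>s\<close> do.\<close>
    have res: "g r * fps_const (of_bool (s - p r \<in> \<int>))
        = bernoulli_gf \<alpha> (of_int a * s - x) * fps_const (of_bool (s - p r \<in> \<int>))" for r
    proof (cases "s - p r \<in> \<int>")
      case True
      then have "of_int a * (s - p r) \<in> \<int>" by (intro Ints_mult) auto
      from bernoulli_gf_add_int[OF this, of \<alpha> "of_int a * (of_int r + y) / of_int b - x"]
      have "bernoulli_gf \<alpha> (of_int a * s - x) = g r"
        by (simp add: g_def p_def algebra_simps)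
      then show ?thesis by simp
    qed simp
    have "(\<Sum>r = 1..\<bar>b\<bar>. g r * fps_const (of_bool (s - p r \<in> \<int>)))
        = bernoulli_gf \<alpha> (of_int a * s - x) * fps_const (\<Sum>r = 1..\<bar>b\<bar>. of_bool (s - p r \<in> \<int>))"
      unfolding res sum_distrib_left[symmetric]
      by (intro arg_cong2[of _ _ _ _ "(*)"] refl fps_ext) (simp add: fps_sum_nth)
    also have "(\<Sum>r = 1..\<bar>b\<bar>. of_bool (s - p r \<in> \<int>)) = (of_bool (of_int b * s - y \<in> \<int>) :: real)"
      unfolding p_def by (rule sum_residue_indicator) (rule assms)
    finally have jump: "(\<Sum>r = 1..\<bar>b\<bar>. g r * fps_const (of_bool (s - p r \<in> \<int>)))
        = bernoulli_gf \<alpha> (of_int a * s - x) * fps_const (of_bool (of_int b * s - y \<in> \<int>))" .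
    have "rademacher_gf a b x y \<alpha> \<gamma> t
        = (\<Sum>r = 1..\<bar>b\<bar>. g r * (fps_exp (\<gamma> * (t - s)) *
            (bernoulli_gf \<gamma> (s - p r) - \<kappa> * fps_const (of_bool (s - p r \<in> \<int>)))))"
      unfolding rademacher_gf_def g_def[symmetric] p_def[symmetric]
    proof (intro sum.cong refl arg_cong2[of _ _ _ _ "(*)"])
      fix r assume r: "r \<in> {1..\<bar>b\<bar>}"
      show "bernoulli_gf \<gamma> (t - p r) = fps_exp (\<gamma> * (t - s)) *
            (bernoulli_gf \<gamma> (s - p r) - \<kappa> * fps_const (of_bool (s - p r \<in> \<int>)))"
        using bspec[OF elim r] by (auto simp: \<kappa>_def)
    qed
    also have "\<dots> = fps_exp (\<gamma> * (t - s)) * ((\<Sum>r = 1..\<bar>b\<bar>. g r * bernoulli_gf \<gamma> (s - p r))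
        - \<kappa> * (\<Sum>r = 1..\<bar>b\<bar>. g r * fps_const (of_bool (s - p r \<in> \<int>))))"
      unfolding sum_distrib_left sum_subtractf[symmetric]
      by (intro sum.cong refl) (simp add: algebra_simps del: fps_const_mult)
    also have "(\<Sum>r = 1..\<bar>b\<bar>. g r * bernoulli_gf \<gamma> (s - p r)) = rademacher_gf a b x y \<alpha> \<gamma> s"
      by (simp add: rademacher_gf_def g_def p_def)
    finally show ?case
      unfolding jump \<kappa>_def fps_const_mult[symmetric] by (simp only: mult_ac)
  qed
qed

lemma rademacher_gf_periodic:
  "rademacher_gf a b x y \<alpha> \<gamma> (t + 1) = rademacher_gf a b x y \<alpha> \<gamma> t"
proof -
  have "bernoulli_gf \<gamma> (t + 1 - w) = bernoulli_gf \<gamma> (t - w)" for w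
    using bernoulli_gf_add_int[of 1 \<gamma> "t - w"] by (simp add: algebra_simps)
  then show ?thesis by (simp add: rademacher_gf_def)
qed

section \<open>The product formula for generating functions\<close>

text \<open>The difference of the two sides satisfies \<open>fps_exp_ode_periodic_unique\<close>.
  Terms linear in the half-jumps cancel between the product and the two sums; the product of two
  half-jumps remains, and the cubic term offsets it where both factors jump.\<close>

lemma bernoulli_gf_product:
  fixes a b :: int and x y \<alpha> \<beta> t :: real
  assumes "a \<noteq> 0" "b \<noteq> 0" and \<gamma>: "\<gamma> = of_int a * \<alpha> + of_int b * \<beta>" and "\<gamma> \<noteq> 0"
  shows "fps_const \<gamma> * fps_X * bernoulli_gf \<alpha> (of_int a * t - x) * bernoulli_gf \<beta> (of_int b * t - y)
     + fps_const (of_int (sgn (a * b)) / 4 * \<alpha> * \<beta> * \<gamma> *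
         of_bool (of_int a * t - x \<in> \<int> \<and> of_int b * t - y \<in> \<int>)) * fps_X ^ 3
   = fps_const (of_int (sgn b) * \<beta>) * fps_X * rademacher_gf a b x y \<alpha> \<gamma> t
     + fps_const (of_int (sgn a) * \<alpha>) * fps_X * rademacher_gf b a y x \<beta> \<gamma> t"
proof -
  define D where "D t =
     fps_const \<gamma> * fps_X * bernoulli_gf \<alpha> (of_int a * t - x) * bernoulli_gf \<beta> (of_int b * t - y)
     + fps_const (of_int (sgn (a * b)) / 4 * \<alpha> * \<beta> * \<gamma> *
         of_bool (of_int a * t - x \<in> \<int> \<and> of_int b * t - y \<in> \<int>)) * fps_X ^ 3
     - fps_const (of_int (sgn b) * \<beta>) * fps_X * rademacher_gf a b x y \<alpha> \<gamma> t
     - fps_const (of_int (sgn a) * \<alpha>) * fps_X * rademacher_gf b a y x \<beta> \<gamma> t" for t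
  have "D t = 0"
  proof (rule fps_exp_ode_periodic_unique)
    fix s :: real
    show "\<forall>\<^sub>F t in nhds s. D t = fps_exp (\<gamma> * (t - s)) * D s"
      using bernoulli_gf_affine_local[OF assms(1), of \<alpha> x s]
        bernoulli_gf_affine_local[OF assms(2), of \<beta> y s]
        rademacher_gf_local[OF assms(2), where s = s and a = a and x = x and y = y and \<alpha> = \<alpha> and \<gamma> = \<gamma>]
        rademacher_gf_local[OF assms(1), where s = s and a = b and x = y and y = x and \<alpha> = \<beta> and \<gamma> = \<gamma>]
    proof eventually_elim
      case (elim t)
      show ?case
      proof (cases "t = s")
        case False
        define P where "P = bernoulli_gf \<alpha> (of_int a * s - x)"
        define Q where "Q = bernoulli_gf \<beta> (of_int b * s - y)"
        define \<tau> where "\<tau> = fps_const (sgn (t - s) / 2)"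
        define \<chi>a where "\<chi>a = fps_const (of_bool (of_int a * s - x \<in> \<int>) :: real)"
        define \<chi>b where "\<chi>b = fps_const (of_bool (of_int b * s - y \<in> \<int>) :: real)"
        define \<sigma>a where "\<sigma>a = fps_const (of_int (sgn a) :: real)"
        define \<sigma>b where "\<sigma>b = fps_const (of_int (sgn b) :: real)"
        define ea where "ea = fps_exp (\<alpha> * of_int a * (t - s))"
        define eb where "eb = fps_exp (\<beta> * of_int b * (t - s))"
        have e: "fps_exp (\<gamma> * (t - s)) = ea * eb"
          unfolding ea_def eb_def \<gamma> fps_exp_add_mult[symmetric]
          by (rule arg_cong[of _ _ fps_exp]) (simp add: algebra_simps)
        \<comment> \<open>Off \<open>s\<close> the sign is 1 or -1, and its square is the source of
          the quarter in the correction term. Writing that quarter as \<open>\<tau> * \<tau>\<close>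
          in \<open>D s\<close> reduces the claim to a polynomial identity.\<close>
        have \<tau>: "\<tau> * \<tau> = fps_const (1 / 4)"
          using False by (simp add: \<tau>_def sgn_if)
        have gfa: "bernoulli_gf \<alpha> (of_int a * t - x) = ea * (P - \<tau> * \<sigma>a * fps_const \<alpha> * \<chi>a * fps_X)"
          using elim(1) by (simp add: ea_def P_def \<tau>_def \<sigma>a_def \<chi>a_def)
        have gfb: "bernoulli_gf \<beta> (of_int b * t - y) = eb * (Q - \<tau> * \<sigma>b * fps_const \<beta> * \<chi>b * fps_X)"
          using elim(2) by (simp add: eb_def Q_def \<tau>_def \<sigma>b_def \<chi>b_def)
        have ra: "rademacher_gf a b x y \<alpha> \<gamma> t
            = ea * eb * (rademacher_gf a b x y \<alpha> \<gamma> s - \<tau> * fps_const \<gamma> * \<chi>b * fps_X * P)"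
          using elim(3) by (simp add: e P_def \<tau>_def \<chi>b_def)
        have rb: "rademacher_gf b a y x \<beta> \<gamma> t
            = ea * eb * (rademacher_gf b a y x \<beta> \<gamma> s - \<tau> * fps_const \<gamma> * \<chi>a * fps_X * Q)"
          using elim(4) by (simp add: e Q_def \<tau>_def \<chi>a_def)
        \<comment> \<open>So the correction term is absent from \<open>D t\<close>, though it may be
          present in \<open>D s\<close>.\<close>
        have "of_int a * t - x \<notin> \<int>" using elim(1) False by blast
        then have Dt: "D t =
            fps_const \<gamma> * fps_X * (ea * (P - \<tau> * \<sigma>a * fps_const \<alpha> * \<chi>a * fps_X))
              * (eb * (Q - \<tau> * \<sigma>b * fps_const \<beta> * \<chi>b * fps_X))
            - \<sigma>b * fps_const \<beta> * fps_X *
              (ea * eb * (rademacher_gf a b x y \<alpha> \<gamma> s - \<tau> * fps_const \<gamma> * \<chi>b * fps_X * P))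
            - \<sigma>a * fps_const \<alpha> * fps_X *
              (ea * eb * (rademacher_gf b a y x \<beta> \<gamma> s - \<tau> * fps_const \<gamma> * \<chi>a * fps_X * Q))"
          unfolding D_def gfa gfb ra rb \<sigma>a_def \<sigma>b_def by simp
        have "fps_const (of_int (sgn (a * b)) / 4 * \<alpha> * \<beta> * \<gamma> *
           of_bool (of_int a * s - x \<in> \<int> \<and> of_int b * s - y \<in> \<int>))
           = (\<tau> * \<tau>) * \<sigma>a * \<sigma>b * fps_const \<alpha> * fps_const \<beta> * fps_const \<gamma> * \<chi>a * \<chi>b"
          unfolding \<tau> by (simp add: \<sigma>a_def \<sigma>b_def \<chi>a_def \<chi>b_def sgn_mult of_bool_conj mult_ac)
        then have Ds: "D s = fps_const \<gamma> * fps_X * P * Q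
            + (\<tau> * \<tau>) * \<sigma>a * \<sigma>b * fps_const \<alpha> * fps_const \<beta> * fps_const \<gamma> * \<chi>a * \<chi>b * fps_X ^ 3
            - \<sigma>b * fps_const \<beta> * fps_X * rademacher_gf a b x y \<alpha> \<gamma> s
            - \<sigma>a * fps_const \<alpha> * fps_X * rademacher_gf b a y x \<beta> \<gamma> s"
          unfolding D_def P_def Q_def \<sigma>a_def \<sigma>b_def by simp
        show ?thesis
          unfolding Dt Ds e by algebra
      qed simp
    qed
  next
    have shift: "bernoulli_gf \<delta> (of_int k * 1 - w) = bernoulli_gf \<delta> (of_int k * 0 - w)"
      "of_int k * 1 - w \<in> \<int> \<longleftrightarrow> of_int k * 0 - w \<in> \<int>" for \<delta> w :: real and k :: int
      using bernoulli_gf_add_int[of "of_int k" \<delta> "- w"] Ints_of_int[of k]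
        Ints_add[of "of_int k" "- w"] Ints_diff[of "of_int k - w" "of_int k"]
      by auto
    show "D 1 = D 0"
      using rademacher_gf_periodic[of a b x y \<alpha> \<gamma> 0] rademacher_gf_periodic[of b a y x \<beta> \<gamma> 0]
      unfolding D_def shift by simp
  qed (rule assms)
  then show ?thesis
    unfolding D_def by (simp only: diff_diff_eq right_minus_eq)
qed

section \<open>Coefficients: Raabe's formula and the case \<open>c = 1\<close>\<close>

text \<open>Up to the sign \<open>(-1) ^ k\<close> from reflecting the second argument, this is
  \<open>dedekind_rademacher_sum j k a 1 b x t y\<close>.\<close>

definition rademacher_pt ::
    "int \<Rightarrow> int \<Rightarrow> real \<Rightarrow> real \<Rightarrow> real \<Rightarrow> nat \<Rightarrow> nat \<Rightarrow> real" where
  "rademacher_pt a b x y t j k =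
     (\<Sum>r = 1..\<bar>b\<bar>. bernoulli_fun j (of_int a * (of_int r + y) / of_int b - x) *
        bernoulli_fun k (t - (of_int r + y) / of_int b))"

lemma rademacher_gf_nth:
  "fps_nth (rademacher_gf a b x y \<alpha> \<gamma> t) N =
     (\<Sum>j\<le>N. rademacher_pt a b x y t j (N - j) / (fact j * fact (N - j)) * \<alpha> ^ j * \<gamma> ^ (N - j))"
proof -
  have "fps_nth (rademacher_gf a b x y \<alpha> \<gamma> t) N = (\<Sum>r = 1..\<bar>b\<bar>. \<Sum>j\<le>N.
      bernoulli_fun j (of_int a * (of_int r + y) / of_int b - x) *
      bernoulli_fun (N - j) (t - (of_int r + y) / of_int b) / (fact j * fact (N - j)) * \<alpha> ^ j * \<gamma> ^ (N - j))"
    by (simp add: rademacher_gf_def fps_sum_nth fps_mult_nth atLeast0AtMost) (simp add: mult_ac)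
  also have "\<dots> = (\<Sum>j\<le>N. rademacher_pt a b x y t j (N - j) / (fact j * fact (N - j)) * \<alpha> ^ j * \<gamma> ^ (N - j))"
    unfolding rademacher_pt_def sum_distrib_right sum_divide_distrib by (rule sum.swap)
  finally show ?thesis .
qed

text \<open>The product formula with \<open>b = 1\<close> and \<open>\<beta> = 0\<close>: every
  \<open>bernoulli_gf 0\<close> is 1 and only one of the two sums survives. Negative
  \<open>a\<close> and jump points are included.\<close>

lemma bernoulli_fun_raabe:
  fixes a :: int
  assumes "a \<noteq> 0"
  shows "of_int a * bernoulli_fun k (of_int a * t - x)
    = of_int (sgn a) * of_int a ^ k * (\<Sum>r = 1..\<bar>a\<bar>. bernoulli_fun k (t - (of_int r + x) / of_int a))"
proof -
  have zero: "bernoulli_gf 0 w = 1" for w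
    by (rule fps_ext) (auto simp: bernoulli_fun_def power_0_left)
  have "fps_nth (fps_const (of_int a) * bernoulli_gf 1 (of_int a * t - x)) k
      = fps_nth (fps_const (of_int (sgn a)) * rademacher_gf 1 a 0 x 0 (of_int a) t) k"
    using bernoulli_gf_product[OF assms, of 1 "of_int a" 1 0 t x 0] assms by (simp add: zero)
  then have "of_int a * bernoulli_fun k (of_int a * t - x) / fact k
     = of_int (sgn a) * of_int a ^ k *
        (\<Sum>r = 1..\<bar>a\<bar>. bernoulli_fun k (t - (of_int r + x) / of_int a)) / fact k"
    by (simp add: rademacher_gf_def zero fps_sum_nth sum_distrib_left sum_divide_distrib mult_ac)
  then show ?thesis by simp
qed

text \<open>Raabe's formula for the multiplier -1, whose only summand is the value at
  \<open>x + 1\<close>.\<close>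

lemma bernoulli_fun_minus: "bernoulli_fun k (- x) = (-1) ^ k * bernoulli_fun k x"
  using bernoulli_fun_raabe[of "-1" k x 0] bernoulli_fun_add_int[of 1 k x] by simp

lemma coeff_linear_poly_power':
  fixes a b :: real
  shows "coeff ([:b, a:] ^ k) i = of_nat (k choose i) * a ^ i * b ^ (k - i)"
proof (cases "i \<le> k")
  case False
  have "degree ([:b, a:] ^ k) \<le> degree [:b, a:] * k" by (rule degree_power_le)
  also have "\<dots> \<le> 1 * k" by (intro mult_right_mono) auto
  finally show ?thesis using False by (simp add: coeff_eq_0 binomial_eq_0)
qed (rule coeff_linear_poly_power)

text \<open>By homogeneity \<open>\<beta> = 1\<close> suffices: the coefficients of
  \<open>X ^ (m + n + 2)\<close> are polynomials in \<open>\<alpha>\<close>, and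
  \<open>\<alpha> ^ Suc m\<close> marks the term with \<open>u ^ Suc m * v ^ Suc n\<close>. Here
  \<open>Suc m\<close> and \<open>Suc n\<close> stand for the \<open>m\<close> and \<open>n\<close>
  of the theorem.\<close>

lemma bernoulli_fun_product:
  fixes a b :: int and x y t :: real
  assumes a: "a \<noteq> 0" and b: "b \<noteq> 0"
  defines "X \<equiv> of_int a * t - x" and "Y \<equiv> of_int b * t - y"
  shows "real (Suc m) * of_int a * bernoulli_fun m X * bernoulli_fun (Suc n) Y
       + real (Suc n) * of_int b * bernoulli_fun (Suc m) X * bernoulli_fun n Y
       + of_int (sgn (a * b)) *
         ((of_bool (m = 1 \<and> n = 0) * real (Suc m) * of_int a
           + of_bool (m = 0 \<and> n = 1) * real (Suc n) * of_int b) / 4) *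
         of_bool (X \<in> \<int> \<and> Y \<in> \<int>)
     = real (Suc n) * of_int b ^ n * of_int (sgn b) *
         (\<Sum>j\<le>Suc m. real (Suc m choose j) * of_int a ^ (Suc m - j) *
            rademacher_pt a b x y t j (Suc (m + n) - j))
       + real (Suc m) * of_int a ^ m * of_int (sgn a) *
         (\<Sum>j\<le>Suc n. real (Suc n choose j) * of_int b ^ (Suc n - j) *
            rademacher_pt b a y x t j (Suc (m + n) - j))"
proof -
  \<comment> \<open>The total degree is \<open>Suc N\<close>; every summand of the product formula
    carries a factor \<open>fps_X\<close>, which leaves \<open>N\<close>.\<close>
  define N where "N = Suc (m + n)"
  define \<epsilon> where "\<epsilon> = of_int (sgn (a * b)) / 4 * (of_bool (X \<in> \<int> \<and> Y \<in> \<int>) :: real)"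
  define \<gamma> where "\<gamma> = [:of_int b, of_int a :: real:]"
  define f where "f i = bernoulli_fun i X * bernoulli_fun (N - i) Y / (fact i * fact (N - i))" for i
  define g where "g j = rademacher_pt a b x y t j (N - j) / (fact j * fact (N - j))" for j
  define h where "h j = rademacher_pt b a y x t j (N - j) / (fact j * fact (N - j))" for j
  \<comment> \<open>The correction is a multiple of \<open>fps_X ^ 3\<close>, so it enters only if
    \<open>Suc N = 3\<close>.\<close>
  define L where "L = \<gamma> * (\<Sum>i\<le>N. monom (f i) i) + (if N = 2 then smult \<epsilon> (pCons 0 \<gamma>) else 0)"
  define R where "R = smult (of_int (sgn b)) (\<Sum>j\<le>N. monom (g j) j * \<gamma> ^ (N - j))
     + smult (of_int (sgn a)) (pCons 0 (\<Sum>j\<le>N. smult (h j) (\<gamma> ^ (N - j))))"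
  have "poly L \<alpha> = poly R \<alpha>" if "poly \<gamma> \<alpha> \<noteq> 0" for \<alpha>
  proof -
    define c where "c = poly \<gamma> \<alpha>"
    have c: "c = of_int a * \<alpha> + of_int b * 1" by (simp add: c_def \<gamma>_def algebra_simps)
    have \<epsilon>': "of_int (sgn (a * b)) / 4 * \<alpha> * 1 * c * of_bool (X \<in> \<int> \<and> Y \<in> \<int>) = \<epsilon> * \<alpha> * c"
      by (simp add: \<epsilon>_def)
    have "fps_nth (fps_const c * fps_X * bernoulli_gf \<alpha> X * bernoulli_gf 1 Y
     + fps_const (\<epsilon> * \<alpha> * c) * fps_X ^ 3) (Suc N)
   = fps_nth (fps_const (of_int (sgn b) * 1) * fps_X * rademacher_gf a b x y \<alpha> c t
     + fps_const (of_int (sgn a) * \<alpha>) * fps_X * rademacher_gf b a y x 1 c t) (Suc N)"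
      using bernoulli_gf_product[OF a b c, where t = t and x = x and y = y] that
      unfolding \<epsilon>'[symmetric] X_def Y_def by (simp only: c_def not_False_eq_True simp_thms)
    moreover have "fps_nth (bernoulli_gf \<alpha> X * bernoulli_gf 1 Y) N = poly (\<Sum>i\<le>N. monom (f i) i) \<alpha>"
      by (simp add: fps_mult_nth atLeast0AtMost poly_sum poly_monom f_def) (simp add: mult_ac)
    moreover have "fps_nth (fps_const k * fps_X ^ 3) (Suc N) = (if N = 2 then k else 0)" for k :: real
      by (simp add: fps_X_power_nth)
    ultimately have "c * poly (\<Sum>i\<le>N. monom (f i) i) \<alpha>
        + (if N = 2 then \<epsilon> * \<alpha> * c else 0)
      = of_int (sgn b) * fps_nth (rademacher_gf a b x y \<alpha> c t) N
        + of_int (sgn a) * \<alpha> * fps_nth (rademacher_gf b a y x 1 c t) N"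
      by (cases "N = 2"; simp only: fps_add_nth mult.assoc fps_mult_left_const_nth fps_X_mult_nth
            nat.distinct if_False if_True diff_Suc_1 mult_1_left mult_zero_right)
    moreover have "poly L \<alpha> = c * poly (\<Sum>i\<le>N. monom (f i) i) \<alpha>
        + (if N = 2 then \<epsilon> * \<alpha> * c else 0)"
      by (simp add: L_def c_def)
    moreover have "poly R \<alpha> = of_int (sgn b) * fps_nth (rademacher_gf a b x y \<alpha> c t) N
        + of_int (sgn a) * \<alpha> * fps_nth (rademacher_gf b a y x 1 c t) N"
      by (simp add: R_def rademacher_gf_nth poly_sum poly_monom g_def h_def c_def)
    ultimately show ?thesis by simp
  qed
  \<comment> \<open>the extra factor \<open>\<gamma>\<close> takes care of the excluded root\<close>
  then have "poly (\<gamma> * (L - R)) \<alpha> = 0" for \<alpha> by auto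
  then have "\<gamma> * (L - R) = 0" using poly_all_0_iff_0 by blast
  moreover have "\<gamma> \<noteq> 0" using a by (simp add: \<gamma>_def)
  ultimately have "L = R" by simp
  \<comment> \<open>These factorials turn the reciprocal ones in \<open>f\<close>, \<open>g\<close>
    and \<open>h\<close> into the binomial coefficients of the claim.\<close>
  then have eq: "fact (Suc m) * fact (Suc n) * coeff L (Suc m)
      = fact (Suc m) * fact (Suc n) * coeff R (Suc m)" by simp
  have "coeff L (Suc m) = of_int a * f m + of_int b * f (Suc m)
      + \<epsilon> * (of_bool (m = 1 \<and> n = 0) * of_int a + of_bool (m = 0 \<and> n = 1) * of_int b)"
    by (auto simp: L_def \<gamma>_def coeff_sum N_def coeff_pCons split: nat.splits)
  then have "fact (Suc m) * fact (Suc n) * coeff L (Suc m)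
      = fact (Suc m) * fact (Suc n) * (of_int a * f m) + fact (Suc m) * fact (Suc n) * (of_int b * f (Suc m))
      + fact (Suc m) * fact (Suc n) *
        (\<epsilon> * (of_bool (m = 1 \<and> n = 0) * of_int a + of_bool (m = 0 \<and> n = 1) * of_int b))"
    by (simp add: distrib_left)
  also have "fact (Suc m) * fact (Suc n) * (of_int a * f m)
      = real (Suc m) * of_int a * bernoulli_fun m X * bernoulli_fun (Suc n) Y"
    by (simp add: f_def N_def fact_Suc[of m] del: fact_Suc of_nat_Suc)
  also have "fact (Suc m) * fact (Suc n) * (of_int b * f (Suc m))
      = real (Suc n) * of_int b * bernoulli_fun (Suc m) X * bernoulli_fun n Y"
    by (simp add: f_def N_def fact_Suc[of n] del: fact_Suc of_nat_Suc)
  also have "fact (Suc m) * fact (Suc n) *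
        (\<epsilon> * (of_bool (m = 1 \<and> n = 0) * of_int a + of_bool (m = 0 \<and> n = 1) * of_int b))
      = of_int (sgn (a * b)) *
         ((of_bool (m = 1 \<and> n = 0) * real (Suc m) * of_int a
           + of_bool (m = 0 \<and> n = 1) * real (Suc n) * of_int b) / 4) *
         of_bool (X \<in> \<int> \<and> Y \<in> \<int>)"
    by (auto simp: \<epsilon>_def)
  finally have left: "fact (Suc m) * fact (Suc n) * coeff L (Suc m) =
     real (Suc m) * of_int a * bernoulli_fun m X * bernoulli_fun (Suc n) Y
       + real (Suc n) * of_int b * bernoulli_fun (Suc m) X * bernoulli_fun n Y
       + of_int (sgn (a * b)) *
         ((of_bool (m = 1 \<and> n = 0) * real (Suc m) * of_int a
           + of_bool (m = 0 \<and> n = 1) * real (Suc n) * of_int b) / 4) *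
         of_bool (X \<in> \<int> \<and> Y \<in> \<int>)" .
  have "coeff (\<Sum>j\<le>N. monom (g j) j * \<gamma> ^ (N - j)) (Suc m)
      = (\<Sum>j\<le>N. if Suc m < j then 0 else g j * coeff (\<gamma> ^ (N - j)) (Suc m - j))"
    by (simp add: coeff_sum coeff_monom_mult)
  also have "\<dots> = (\<Sum>j\<le>Suc m. g j * coeff (\<gamma> ^ (N - j)) (Suc m - j))"
    by (intro sum.mono_neutral_cong_right) (auto simp: N_def)
  finally have "fact (Suc m) * fact (Suc n) * coeff (\<Sum>j\<le>N. monom (g j) j * \<gamma> ^ (N - j)) (Suc m)
     = (\<Sum>j\<le>Suc m. fact (Suc m) * fact (Suc n) * (g j * coeff (\<gamma> ^ (N - j)) (Suc m - j)))"
    by (simp only: sum_distrib_left)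
  also have "\<dots> = (\<Sum>j\<le>Suc m. real (Suc n) * of_int b ^ n * (real (Suc m choose j) * of_int a ^ (Suc m - j) *
            rademacher_pt a b x y t j (N - j)))"
  proof (intro sum.cong refl)
    fix j assume j: "j \<in> {..Suc m}"
    have "N - j - (Suc m - j) = n" using j by (auto simp: N_def)
    then have 1: "coeff (\<gamma> ^ (N - j)) (Suc m - j)
        = fact (N - j) / (fact (Suc m - j) * fact n) * of_int a ^ (Suc m - j) * of_int b ^ n"
      unfolding \<gamma>_def coeff_linear_poly_power' using j by (subst binomial_fact) (auto simp: N_def)
    have 2: "real (Suc m choose j) = fact (Suc m) / (fact j * fact (Suc m - j))"
      using j by (subst binomial_fact) auto
    have 3: "fact (Suc n) = real (Suc n) * fact n" by simp
    show "fact (Suc m) * fact (Suc n) * (g j * coeff (\<gamma> ^ (N - j)) (Suc m - j))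
       = real (Suc n) * of_int b ^ n * (real (Suc m choose j) * of_int a ^ (Suc m - j) *
            rademacher_pt a b x y t j (N - j))"
      unfolding g_def 1 2 3 by (simp del: fact_Suc of_nat_Suc)
  qed
  finally have r1: "fact (Suc m) * fact (Suc n) * coeff (\<Sum>j\<le>N. monom (g j) j * \<gamma> ^ (N - j)) (Suc m)
     = real (Suc n) * of_int b ^ n * (\<Sum>j\<le>Suc m. real (Suc m choose j) * of_int a ^ (Suc m - j) *
            rademacher_pt a b x y t j (N - j))"
    by (simp only: sum_distrib_left)
  have "coeff (pCons 0 (\<Sum>j\<le>N. smult (h j) (\<gamma> ^ (N - j)))) (Suc m)
      = (\<Sum>j\<le>N. h j * coeff (\<gamma> ^ (N - j)) m)"
    by (simp add: coeff_sum)
  \<comment> \<open>For \<open>j > Suc n\<close> the degree \<open>N - j\<close> is below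
    \<open>m\<close>.\<close>
  also have "\<dots> = (\<Sum>j\<le>Suc n. h j * coeff (\<gamma> ^ (N - j)) m)"
    by (intro sum.mono_neutral_right) (auto simp: N_def \<gamma>_def coeff_linear_poly_power' intro!: binomial_eq_0)
  finally have "fact (Suc m) * fact (Suc n) * coeff (pCons 0 (\<Sum>j\<le>N. smult (h j) (\<gamma> ^ (N - j)))) (Suc m)
     = (\<Sum>j\<le>Suc n. fact (Suc m) * fact (Suc n) * (h j * coeff (\<gamma> ^ (N - j)) m))"
    by (simp only: sum_distrib_left)
  also have "\<dots> = (\<Sum>j\<le>Suc n. real (Suc m) * of_int a ^ m * (real (Suc n choose j) * of_int b ^ (Suc n - j) *
            rademacher_pt b a y x t j (N - j)))"
  proof (intro sum.cong refl)
    fix j assume j: "j \<in> {..Suc n}"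
    have "N - j - m = Suc n - j" using j by (auto simp: N_def)
    then have 1: "coeff (\<gamma> ^ (N - j)) m
        = fact (N - j) / (fact m * fact (Suc n - j)) * of_int a ^ m * of_int b ^ (Suc n - j)"
      unfolding \<gamma>_def coeff_linear_poly_power' using j by (subst binomial_fact) (auto simp: N_def)
    have 2: "real (Suc n choose j) = fact (Suc n) / (fact j * fact (Suc n - j))"
      using j by (subst binomial_fact) auto
    have 3: "fact (Suc m) = real (Suc m) * fact m" by simp
    show "fact (Suc m) * fact (Suc n) * (h j * coeff (\<gamma> ^ (N - j)) m)
       = real (Suc m) * of_int a ^ m * (real (Suc n choose j) * of_int b ^ (Suc n - j) *
            rademacher_pt b a y x t j (N - j))"
      unfolding h_def 1 2 3 by (simp del: fact_Suc of_nat_Suc)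
  qed
  finally have r2: "fact (Suc m) * fact (Suc n) * coeff (pCons 0 (\<Sum>j\<le>N. smult (h j) (\<gamma> ^ (N - j)))) (Suc m)
     = real (Suc m) * of_int a ^ m * (\<Sum>j\<le>Suc n. real (Suc n choose j) * of_int b ^ (Suc n - j) *
            rademacher_pt b a y x t j (N - j))"
    by (simp only: sum_distrib_left)
  have "fact (Suc m) * fact (Suc n) * coeff R (Suc m)
     = of_int (sgn b) * (fact (Suc m) * fact (Suc n) * coeff (\<Sum>j\<le>N. monom (g j) j * \<gamma> ^ (N - j)) (Suc m))
     + of_int (sgn a) * (fact (Suc m) * fact (Suc n) *
         coeff (pCons 0 (\<Sum>j\<le>N. smult (h j) (\<gamma> ^ (N - j)))) (Suc m))"
    unfolding R_def coeff_add coeff_smult by (simp only: algebra_simps)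
  then show ?thesis
    using eq unfolding r1 r2 left by (simp only: mult_ac N_def)
qed

section \<open>From \<open>c = 1\<close> to general \<open>c\<close>\<close>

text \<open>After exchanging the sums, reflection and Raabe's formula with multiplier
  \<open>c\<close> collapse the sum over \<open>q\<close> to a multiple of
  \<open>bernoulli_fun k (c p - z)\<close>. The exponent \<open>k - 1\<close> is an integer, being
  -1 for \<open>k = 0\<close>.\<close>

lemma sum_rademacher_pt:
  fixes a b c :: int
  assumes c: "c \<noteq> 0"
  shows "(\<Sum>q = 1..\<bar>c\<bar>. rademacher_pt a b x y ((of_int q + z) / of_int c) j k)
    = of_int (sgn c) * (-1) ^ k / of_int c powi (int k - 1) * dedekind_rademacher_sum j k a c b x z y"
proof -
  have inner: "(\<Sum>q = 1..\<bar>c\<bar>. bernoulli_fun k ((of_int q + z) / of_int c - p))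
      = of_int (sgn c) * (-1) ^ k / of_int c powi (int k - 1) * bernoulli_fun k (of_int c * p - z)" for p
  proof -
    have "(\<Sum>q = 1..\<bar>c\<bar>. bernoulli_fun k ((of_int q + z) / of_int c - p))
        = (-1) ^ k * (\<Sum>q = 1..\<bar>c\<bar>. bernoulli_fun k (p - (of_int q + z) / of_int c))"
      unfolding sum_distrib_left
      by (intro sum.cong refl) (simp flip: bernoulli_fun_minus)
    also have "(\<Sum>q = 1..\<bar>c\<bar>. bernoulli_fun k (p - (of_int q + z) / of_int c))
        = of_int (sgn c) * of_int c / of_int c ^ k * bernoulli_fun k (of_int c * p - z)"
      using bernoulli_fun_raabe[OF c, of k p z] c by (simp add: sgn_if field_simps)
    also have "of_int (sgn c) * of_int c / of_int c ^ k = of_int (sgn c) / (of_int c powi (int k - 1) :: real)"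
      using c by (simp add: power_int_diff)
    finally show ?thesis by simp
  qed
  have "(\<Sum>q = 1..\<bar>c\<bar>. rademacher_pt a b x y ((of_int q + z) / of_int c) j k)
      = (\<Sum>r = 1..\<bar>b\<bar>. bernoulli_fun j (of_int a * (of_int r + y) / of_int b - x) *
          (\<Sum>q = 1..\<bar>c\<bar>. bernoulli_fun k ((of_int q + z) / of_int c - (of_int r + y) / of_int b)))"
    unfolding rademacher_pt_def sum_distrib_left by (rule sum.swap)
  then show ?thesis
    unfolding inner dedekind_rademacher_sum_def by (simp add: sum_distrib_left mult_ac)
qed

section \<open>Counting the common jumps\<close>

text \<open>Moving the window by one step exchanges \<open>g K\<close> for the equal value
  \<open>g (K + d)\<close>; induction runs in both directions from \<open>M\<close>.\<close>

lemma sum_int_periodic_shift: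
  fixes g :: "int \<Rightarrow> 'a :: ab_group_add"
  assumes per: "\<And>t. g (t + d) = g t" and "d \<ge> 0"
  shows "sum g {L..<L + d} = sum g {M..<M + d}"
proof -
  have step: "sum g {K..<K + d} = sum g {K + 1..<K + 1 + d}" for K
  proof -
    have "sum g {K..<K + d} + g (K + d) = sum g (insert (K + d) {K..<K + d})"
      by (subst sum.insert) (auto simp: add.commute)
    also have "insert (K + d) {K..<K + d} = insert K {K + 1..<K + 1 + d}"
      using \<open>d \<ge> 0\<close> by auto
    also have "sum g \<dots> = sum g {K + 1..<K + 1 + d} + g K"
      by (subst sum.insert) (auto simp: add.commute)
    finally show ?thesis by (simp add: per)
  qed
  show ?thesis
  proof (induction L rule: int_induct[where k = M])
    case (step2 i)
    then show ?case using step[of "i - 1"] by simp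
  qed (use step in simp_all)
qed

text \<open>In a triple \<open>t\<close> determines \<open>r\<close> and \<open>s\<close>, so it is
  enough to count the admissible \<open>t\<close>. The inequalities confine \<open>t\<close> to
  \<open>\<bar>c\<bar>\<close> consecutive integers, and the integrality conditions have period
  \<open>\<bar>c\<bar>\<close>, so this window may be moved to
  \<open>1..\<bar>c\<bar>\<close>.\<close>

lemma card_common_lattice_points:
  fixes a b c :: int and x y z :: real
  assumes a: "a \<noteq> 0" and b: "b \<noteq> 0" and c: "c \<noteq> 0"
  shows "real (card {(r :: int, s :: int, t :: int).
             0 \<le> of_int (sgn c) * ((of_int r + x) / of_int a) \<and>
             of_int (sgn c) * ((of_int r + x) / of_int a)
               = of_int (sgn c) * ((of_int s + y) / of_int b) \<and>
             of_int (sgn c) * ((of_int s + y) / of_int b)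
               = of_int (sgn c) * ((of_int t + z) / of_int c) \<and>
             of_int (sgn c) * ((of_int t + z) / of_int c) < 1})
    = (\<Sum>q = 1..\<bar>c\<bar>. of_bool (of_int a * ((of_int q + z) / of_int c) - x \<in> \<int> \<and>
         of_int b * ((of_int q + z) / of_int c) - y \<in> \<int>))"
    (is "real (card ?S) = _")
proof -
  define P where "P t \<longleftrightarrow> of_int a * ((of_int t + z) / of_int c) - x \<in> \<int> \<and>
      of_int b * ((of_int t + z) / of_int c) - y \<in> \<int>" for t :: int
  have sc: "real_of_int (sgn c) \<noteq> 0" using c by (simp add: sgn_if)
  have sgnc: "real_of_int (sgn c) * (w / of_int c) = w / of_int \<bar>c\<bar>" for w
    using c by (simp add: sgn_if)
  have pos: "real_of_int \<bar>c\<bar> > 0" using c by simp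
  \<comment> \<open>The least integer \<open>t\<close> with \<open>t + z \<ge> 0\<close>; by
    \<open>sgnc\<close> the quantity to be bounded is
    \<open>(t + z) / \<bar>c\<bar>\<close>.\<close>
  define L where "L = \<lceil>- z\<rceil>"
  have range: "0 \<le> of_int (sgn c) * ((of_int t + z) / of_int c) \<and>
       of_int (sgn c) * ((of_int t + z) / of_int c) < 1 \<longleftrightarrow> t \<in> {L..<L + \<bar>c\<bar>}" for t :: int
  proof -
    have "0 \<le> of_int t + z \<longleftrightarrow> L \<le> t" unfolding L_def by linarith
    moreover have "of_int t + z < of_int \<bar>c\<bar> \<longleftrightarrow> t < L + \<bar>c\<bar>" unfolding L_def by linarith
    ultimately show ?thesis unfolding sgnc using pos by (simp add: field_simps)
  qed
  have eqv: "of_int (sgn c) * ((of_int r + x) / of_int a) = of_int (sgn c) * w \<longleftrightarrow>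
      of_int r = of_int a * w - x"
    "of_int (sgn c) * ((of_int r + y) / of_int b) = of_int (sgn c) * w \<longleftrightarrow>
      of_int r = of_int b * w - y" for r :: int and w
    unfolding mult_cancel_left using a b sc by (auto simp: field_simps)
  define S where "S = ?S"
  have S: "(r, s, t) \<in> S \<longleftrightarrow> t \<in> {L..<L + \<bar>c\<bar>} \<and>
      of_int r = of_int a * ((of_int t + z) / of_int c) - x \<and>
      of_int s = of_int b * ((of_int t + z) / of_int c) - y" for r s t
  proof -
    have "(r, s, t) \<in> S \<longleftrightarrow>
        (0 \<le> of_int (sgn c) * ((of_int t + z) / of_int c) \<and>
         of_int (sgn c) * ((of_int t + z) / of_int c) < 1) \<and>
        of_int (sgn c) * ((of_int r + x) / of_int a) = of_int (sgn c) * ((of_int t + z) / of_int c) \<and>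
        of_int (sgn c) * ((of_int s + y) / of_int b) = of_int (sgn c) * ((of_int t + z) / of_int c)"
      unfolding S_def mem_Collect_eq prod.case by (smt (verit, ccfv_threshold))
    then show ?thesis unfolding range eqv .
  qed
  have "inj_on (\<lambda>u. snd (snd u)) S"
  proof (rule inj_onI)
    fix u v assume uv: "u \<in> S" "v \<in> S" "snd (snd u) = snd (snd v)"
    obtain r s t r' s' t' where "u = (r, s, t)" "v = (r', s', t')"
      by (metis prod_cases3)
    moreover from this uv have "real_of_int r = of_int r'" "real_of_int s = of_int s'"
      by (auto simp only: S snd_conv)
    ultimately show "u = v" using uv by simp
  qed
  moreover have "(\<lambda>u. snd (snd u)) ` S = {t \<in> {L..<L + \<bar>c\<bar>}. P t}"
  proof (intro equalityI subsetI)
    fix t assume "t \<in> (\<lambda>u. snd (snd u)) ` S"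
    then obtain r s where rst: "(r, s, t) \<in> S" by auto
    then have "P t" unfolding P_def S by (metis Ints_of_int)
    with rst show "t \<in> {t \<in> {L..<L + \<bar>c\<bar>}. P t}" by (simp only: S mem_Collect_eq simp_thms)
  next
    fix t assume t: "t \<in> {t \<in> {L..<L + \<bar>c\<bar>}. P t}"
    then obtain r s where "of_int a * ((of_int t + z) / of_int c) - x = of_int r"
      "of_int b * ((of_int t + z) / of_int c) - y = of_int s"
      unfolding P_def by (blast elim: Ints_cases)
    then have "(r, s, t) \<in> S" using t unfolding S by simp
    then show "t \<in> (\<lambda>u. snd (snd u)) ` S" by force
  qed
  ultimately have "card S = card {t \<in> {L..<L + \<bar>c\<bar>}. P t}"
    by (metis card_image)
  also have "real \<dots> = (\<Sum>t = L..<L + \<bar>c\<bar>. of_bool (P t))"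
    by (simp add: of_bool_def sum.If_cases Int_def)
  also have "\<dots> = (\<Sum>t = 1..<1 + \<bar>c\<bar>. of_bool (P t))"
  proof (rule sum_int_periodic_shift)
    fix t :: int
    have shift: "of_int k * ((of_int (t + \<bar>c\<bar>) + z) / of_int c) - w
        = of_int k * ((of_int t + z) / of_int c) - w + of_int (k * sgn c)" for k :: int and w
      using c by (simp add: sgn_if field_simps)
    have "P (t + \<bar>c\<bar>) \<longleftrightarrow> P t"
      unfolding P_def shift by (simp only: add_in_Ints_iff_right Ints_of_int)
    then show "of_bool (P (t + \<bar>c\<bar>)) = (of_bool (P t) :: real)" by simp
  qed simp
  also have "{1..<1 + \<bar>c\<bar>} = {1..\<bar>c\<bar>}" by auto
  finally show ?thesis unfolding P_def S_def .
qed

section \<open>Reciprocity, by summing the case \<open>c = 1\<close> over the points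
  \<open>(q + z) / c\<close>\<close>

theorem theorem4p4:
  fixes m n :: nat and a b c :: int and x y z :: real
  assumes "m \<ge> 1" and "n \<ge> 1" and "a \<noteq> 0" and "b \<noteq> 0" and "c \<noteq> 0"
  shows
    "real m * of_int a * dedekind_rademacher_sum (m - 1) n a b c x y z
       + real n * of_int b * dedekind_rademacher_sum m (n - 1) a b c x y z
     = (-1) ^ (n - 1) * real n * of_int b ^ (n - 1) * of_int (sgn (b * c)) *
         (\<Sum>j = 0..m. real (m choose j) *
            ((-1) ^ (m - j) * of_int a ^ (m - j)
               / of_int c powi (int m + int n - int j - 2)) *
            dedekind_rademacher_sum j (m + n - j - 1) a c b x z y)
       + (-1) ^ (m - 1) * real m * of_int a ^ (m - 1) * of_int (sgn (a * c)) *
         (\<Sum>j = 0..n. real (n choose j) *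
            ((-1) ^ (n - j) * of_int b ^ (n - j)
               / of_int c powi (int m + int n - int j - 2)) *
            dedekind_rademacher_sum j (m + n - j - 1) b c a y z x)
       - of_int (sgn (a * b)) *
         ((of_bool (1 = m - 1) * of_bool (1 = n) * real m * of_int a
           + of_bool (1 = m) * of_bool (1 = n - 1) * real n * of_int b) / 4) *
         real (card {(r :: int, s :: int, t :: int).
             0 \<le> of_int (sgn c) * ((of_int r + x) / of_int a) \<and>
             of_int (sgn c) * ((of_int r + x) / of_int a)
               = of_int (sgn c) * ((of_int s + y) / of_int b) \<and>
             of_int (sgn c) * ((of_int s + y) / of_int b)
               = of_int (sgn c) * ((of_int t + z) / of_int c) \<and>
             of_int (sgn c) * ((of_int t + z) / of_int c) < 1})"
proof -
  obtain m' where m: "m = Suc m'" using assms(1) by (cases m) auto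
  obtain n' where n: "n = Suc n'" using assms(2) by (cases n) auto
  note a = assms(3) and b = assms(4) and c = assms(5)
  define t where "t q = (of_int q + z) / of_int c" for q :: int
  define E where "E = of_int (sgn (a * b)) *
      ((of_bool (1 = m - 1) * of_bool (1 = n) * real m * of_int a
        + of_bool (1 = m) * of_bool (1 = n - 1) * real n * of_int b) / (4 :: real))"
  \<comment> \<open>This serves both sums on the right: \<open>l\<close> is \<open>n - 1\<close> for
    \<open>k = m\<close> and \<open>m - 1\<close> for \<open>k = n\<close>. The sign
    \<open>(-1) ^ (m + n - j - 1)\<close> from \<open>sum_rademacher_pt\<close> splits into
    \<open>(-1) ^ l\<close> and \<open>(-1) ^ (k - j)\<close>.\<close>
  have scale: "of_int (sgn d) * (\<Sum>j\<le>k. real (k choose j) * of_int e ^ (k - j) *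
        (\<Sum>q = 1..\<bar>c\<bar>. rademacher_pt e d u v (t q) j (Suc (m' + n') - j)))
      = (-1) ^ l * of_int (sgn (d * c)) *
         (\<Sum>j = 0..k. real (k choose j) *
            ((-1) ^ (k - j) * of_int e ^ (k - j)
               / of_int c powi (int m + int n - int j - 2)) *
            dedekind_rademacher_sum j (m + n - j - 1) e c d u z v)"
    if k: "k + l = Suc (m' + n')" for k l :: nat and d e :: int and u v :: real
  proof -
    define S where "S j = (\<Sum>q = 1..\<bar>c\<bar>. rademacher_pt e d u v (t q) j (Suc (m' + n') - j))" for j
    define T where "T j = (-1) ^ (k - j) * of_int e ^ (k - j) / (of_int c powi (int m + int n - int j - 2) :: real)" for j
    define V where "V j = dedekind_rademacher_sum j (m + n - j - 1) e c d u z v" for j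
    have S: "of_int e ^ (k - j) * S j = (-1) ^ l * of_int (sgn c) * (T j * V j)" if j: "j \<le> k" for j
    proof -
      have 1: "Suc (m' + n') - j = m + n - j - 1" "int (m + n - j - 1) - 1 = int m + int n - int j - 2"
        using j k by (auto simp: m n)
      have "m + n - j - 1 = l + (k - j)" using j k by (auto simp: m n)
      then have "(-1 :: real) ^ (m + n - j - 1) = (-1) ^ l * (-1) ^ (k - j)"
        by (simp only: power_add)
      then show ?thesis
        unfolding S_def T_def V_def t_def 1(1) sum_rademacher_pt[OF c] 1(2) by simp
    qed
    have "of_int (sgn d) * (\<Sum>j\<le>k. real (k choose j) * of_int e ^ (k - j) * S j)
       = (-1) ^ l * of_int (sgn (d * c)) * (\<Sum>j\<le>k. real (k choose j) * T j * V j)"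
      unfolding sum_distrib_left
    proof (intro sum.cong refl)
      fix j assume "j \<in> {..k}"
      then show "of_int (sgn d) * (real (k choose j) * of_int e ^ (k - j) * S j)
         = (-1) ^ l * of_int (sgn (d * c)) * (real (k choose j) * T j * V j)"
        using S[of j] by (simp add: sgn_mult mult.assoc)
    qed
    then show ?thesis unfolding S_def T_def V_def atLeast0AtMost .
  qed
  have pull: "(\<Sum>q = 1..\<bar>c\<bar>. A * (\<Sum>j\<le>k. B j * F q j)) = A * (\<Sum>j\<le>k. B j * (\<Sum>q = 1..\<bar>c\<bar>. F q j))"
    for A :: real and B and F :: "int \<Rightarrow> nat \<Rightarrow> real" and k
    unfolding sum_distrib_left by (rule sum.swap)
  have "(\<Sum>q = 1..\<bar>c\<bar>. real m * of_int a * bernoulli_fun (m - 1) (of_int a * t q - x) * bernoulli_fun n (of_int b * t q - y)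
       + real n * of_int b * bernoulli_fun m (of_int a * t q - x) * bernoulli_fun (n - 1) (of_int b * t q - y)
       + E * of_bool (of_int a * t q - x \<in> \<int> \<and> of_int b * t q - y \<in> \<int>))
     = (\<Sum>q = 1..\<bar>c\<bar>. real n * of_int b ^ n' * of_int (sgn b) *
         (\<Sum>j\<le>m. real (m choose j) * of_int a ^ (m - j) * rademacher_pt a b x y (t q) j (Suc (m' + n') - j))
       + real m * of_int a ^ m' * of_int (sgn a) *
         (\<Sum>j\<le>n. real (n choose j) * of_int b ^ (n - j) * rademacher_pt b a y x (t q) j (Suc (m' + n') - j)))"
  proof (rule sum.cong[OF refl])
    fix q
    have "E = of_int (sgn (a * b)) *
         ((of_bool (m' = 1 \<and> n' = 0) * real (Suc m') * of_int a
           + of_bool (m' = 0 \<and> n' = 1) * real (Suc n') * of_int b) / 4)"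
      by (auto simp: E_def m n)
    then show "real m * of_int a * bernoulli_fun (m - 1) (of_int a * t q - x) * bernoulli_fun n (of_int b * t q - y)
       + real n * of_int b * bernoulli_fun m (of_int a * t q - x) * bernoulli_fun (n - 1) (of_int b * t q - y)
       + E * of_bool (of_int a * t q - x \<in> \<int> \<and> of_int b * t q - y \<in> \<int>)
       = real n * of_int b ^ n' * of_int (sgn b) *
         (\<Sum>j\<le>m. real (m choose j) * of_int a ^ (m - j) * rademacher_pt a b x y (t q) j (Suc (m' + n') - j))
       + real m * of_int a ^ m' * of_int (sgn a) *
         (\<Sum>j\<le>n. real (n choose j) * of_int b ^ (n - j) * rademacher_pt b a y x (t q) j (Suc (m' + n') - j))"
      using bernoulli_fun_product[OF a b, of m' "t q" x n' y] unfolding m n diff_Suc_1 by (simp only:)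
  qed
  also have "\<dots> = real n * of_int b ^ n' * (of_int (sgn b) *
         (\<Sum>j\<le>m. real (m choose j) * of_int a ^ (m - j) *
            (\<Sum>q = 1..\<bar>c\<bar>. rademacher_pt a b x y (t q) j (Suc (m' + n') - j))))
       + real m * of_int a ^ m' * (of_int (sgn a) *
         (\<Sum>j\<le>n. real (n choose j) * of_int b ^ (n - j) *
            (\<Sum>q = 1..\<bar>c\<bar>. rademacher_pt b a y x (t q) j (Suc (m' + n') - j))))"
    unfolding sum.distrib pull by (simp only: mult.assoc)
  also have "\<dots> = (-1) ^ (n - 1) * real n * of_int b ^ (n - 1) * of_int (sgn (b * c)) *
         (\<Sum>j = 0..m. real (m choose j) *
            ((-1) ^ (m - j) * of_int a ^ (m - j)
               / of_int c powi (int m + int n - int j - 2)) *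
            dedekind_rademacher_sum j (m + n - j - 1) a c b x z y)
       + (-1) ^ (m - 1) * real m * of_int a ^ (m - 1) * of_int (sgn (a * c)) *
         (\<Sum>j = 0..n. real (n choose j) *
            ((-1) ^ (n - j) * of_int b ^ (n - j)
               / of_int c powi (int m + int n - int j - 2)) *
            dedekind_rademacher_sum j (m + n - j - 1) b c a y z x)"
  proof -
    have mn: "m + (n - 1) = Suc (m' + n')" "n + (m - 1) = Suc (m' + n')" "n' = n - 1" "m' = m - 1"
      by (auto simp: m n)
    show ?thesis
      unfolding scale[OF mn(1)] scale[OF mn(2)] unfolding mn(3,4) by (simp only: mult_ac)
  qed
  \<comment> \<open>On the left no multiplication formula is needed: \<open>q\<close> is itself the
    summation index of the two sums in the theorem, and the indicators add up to the number of
    triples.\<close>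
  also have "(\<Sum>q = 1..\<bar>c\<bar>. real m * of_int a * bernoulli_fun (m - 1) (of_int a * t q - x) * bernoulli_fun n (of_int b * t q - y)
       + real n * of_int b * bernoulli_fun m (of_int a * t q - x) * bernoulli_fun (n - 1) (of_int b * t q - y)
       + E * of_bool (of_int a * t q - x \<in> \<int> \<and> of_int b * t q - y \<in> \<int>))
     = real m * of_int a * dedekind_rademacher_sum (m - 1) n a b c x y z
       + real n * of_int b * dedekind_rademacher_sum m (n - 1) a b c x y z
       + E * (\<Sum>q = 1..\<bar>c\<bar>. of_bool (of_int a * t q - x \<in> \<int> \<and> of_int b * t q - y \<in> \<int>))"
    unfolding dedekind_rademacher_sum_def sum.distrib sum_distrib_left t_def times_divide_eq_right
    by (simp only: mult.assoc)
  finally show ?thesis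
    unfolding card_common_lattice_points[OF a b c] E_def[symmetric] t_def
    by (simp only: eq_diff_eq)
qed

end
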